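(* Let $\phi$ be a function analytic in a neighborhood of $\infty$ (except for a simple pole at $\infty$) with a Laurent expansion at $\infty$ of the form $$\phi(z)=cz+c_0+\frac{c_{-1}}{z}+\frac{c_{-2}}{z^2}+\cdots,\qquad c>0.$$ For each integer $n\ge 0$ let $\hat F_n$ be the $n$th monic Faber polynomial associated to $\phi$, and for all sufficiently large $r$ let $T_{n,L_r}$ be the Chebyshev polynomial of degree $n$ for the level curve $L_r=\{z\in\mathbb{C}:|\phi(z)|=r\}$. Then for all $n\ge 0$, $$\lim_{r\to\infty}T_{n,L_r}(z)=\hat F_n(z),\qquad z\in\mathbb{C}.$$
   Context: Faber polynomials: for each integer $n\ge 0$, the Faber polynomial $F_n$ of degree $n$ associated to $\phi$ is the polynomial part (the sum of the terms with nonnegative powers of $z$) of the Laurent expansion at $\infty$ of $\phi(z)^n$. Its leading coefficient is $c^n$, and the monic Faber polynomial is $\hat F_n(z)=c^{-n}F_n(z)$. Chebyshev polynomials: for a compact set $K\subset\mathbb{C}$ with infinitely many points and an integer $n\ge 0$, $T_{n,K}$ denotes the unique monic polynomial of degree $n$ that minimizes $\max_{z\in K}|p(z)|$ among all monic polynomials $p$ of degree $n$ with complex coefficients. Level curves: $\phi$ is univalent in a neighborhood of $\infty$. Fix $R>0$ such that $\phi$ is analytic and univalent on $\{|z|>R\}$. There is $r_0>0$ such that $\phi(\{|z|>R\})\supset\{w\in\mathbb{C}:|w|>r_0\}$; for $r>r_0$ the level curve is understood as $L_r=\{z\in\mathbb{C}:|z|>R,\ |\phi(z)|=r\}$, which is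 an analytic Jordan curve. For all sufficiently large $r$, the set $L_r$ does not depend on the choice of $R$. *)

theory Defs
  imports "HOL-Complex_Analysis.Complex_Analysis"
begin

text \<open>
  The Laurent expansion of \<open>f\<close> at infinity is encoded by the library's Laurent expansion of
  \<open>w \<mapsto> f (1/w)\<close> at \<open>0\<close>, so the coefficient of \<open>z\<^sup>k\<close> is the coefficient with index \<open>-k\<close> of
  the formal Laurent series. The library's \<^const>\<open>fls_prpart\<close> collects the terms with
  \<open>k \<ge> 1\<close> as a polynomial in \<open>z\<close>, without the constant term.
\<close>

definition laurent_expansion_at_infinity :: "(complex \<Rightarrow> complex) \<Rightarrow> complex fls" where
  "laurent_expansion_at_infinity f = laurent_expansion (\<lambda>w. f (1 / w)) 0"

definition polynomial_part_at_infinity :: "(complex \<Rightarrow> complex) \<Rightarrow> complex poly" where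
  "polynomial_part_at_infinity f =
     (let L = laurent_expansion_at_infinity f in [:fls_nth L 0:] + fls_prpart L)"

definition faber_poly :: "(complex \<Rightarrow> complex) \<Rightarrow> nat \<Rightarrow> complex poly" where
  "faber_poly \<phi> n = polynomial_part_at_infinity (\<lambda>z. \<phi> z ^ n)"

text \<open>Here \<open>c\<close> stands for the coefficient of \<open>z\<close> in the expansion of \<open>\<phi>\<close> at infinity.\<close>

definition monic_faber_poly :: "(complex \<Rightarrow> complex) \<Rightarrow> real \<Rightarrow> nat \<Rightarrow> complex poly" where
  "monic_faber_poly \<phi> c n = smult (1 / of_real c ^ n) (faber_poly \<phi> n)"

definition monic_of_degree :: "nat \<Rightarrow> complex poly \<Rightarrow> bool" where
  "monic_of_degree n p \<longleftrightarrow> degree p = n \<and> lead_coeff p = 1"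

text \<open>Meaningful for compact nonempty \<open>K\<close>, where the supremum is a maximum.\<close>

definition max_norm_on :: "complex set \<Rightarrow> complex poly \<Rightarrow> real" where
  "max_norm_on K p = (SUP z\<in>K. norm (poly p z))"

definition is_chebyshev_poly :: "nat \<Rightarrow> complex set \<Rightarrow> complex poly \<Rightarrow> bool" where
  "is_chebyshev_poly n K p \<longleftrightarrow>
     monic_of_degree n p \<and> (\<forall>q. monic_of_degree n q \<longrightarrow> max_norm_on K p \<le> max_norm_on K q)"

text \<open>Well defined when \<open>K\<close> is compact and infinite.\<close>

definition chebyshev_poly :: "nat \<Rightarrow> complex set \<Rightarrow> complex poly" where
  "chebyshev_poly n K = (THE p. is_chebyshev_poly n K p)"

definition level_curve :: "(complex \<Rightarrow> complex) \<Rightarrow> real \<Rightarrow> real \<Rightarrow> complex set" where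
  "level_curve \<phi> R r = {z. norm z > R \<and> norm (\<phi> z) = r}"

text \<open>
  The coefficient of \<open>z\<^sup>-\<^sup>k\<close> (\<open>k \<ge> 0\<close>) is \<open>a k\<close>. Convergence of the series near infinity
  includes analyticity of \<open>\<phi>\<close> there.
\<close>

definition has_expansion_at_infinity ::
    "(complex \<Rightarrow> complex) \<Rightarrow> real \<Rightarrow> (nat \<Rightarrow> complex) \<Rightarrow> bool" where
  "has_expansion_at_infinity \<phi> c a \<longleftrightarrow>
     (\<forall>\<^sub>F z in at_infinity. (\<lambda>k. a k / z ^ k) sums (\<phi> z - of_real c * z))"

text \<open>
  An admissible radius \<open>R\<close> for \<^const>\<open>level_curve\<close> always exists.
\<close>

lemma univalent_near_infinity:
  assumes c: "c > 0" and exp: "has_expansion_at_infinity \<phi> c a"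
  shows "\<exists>R>0. \<phi> analytic_on {z. norm z > R} \<and> inj_on \<phi> {z. norm z > R}"
proof -
  obtain B0 where B0: "\<And>z. norm z \<ge> B0 \<Longrightarrow> (\<lambda>k. a k / z ^ k) sums (\<phi> z - of_real c * z)"
    using exp unfolding has_expansion_at_infinity_def eventually_at_infinity by blast
  define B where "B = max B0 1"
  have B: "B \<ge> 1" "\<And>z. norm z \<ge> B \<Longrightarrow> (\<lambda>k. a k / z ^ k) sums (\<phi> z - of_real c * z)"
    using B0 by (auto simp: B_def)
  define g where "g = (\<lambda>w::complex. \<Sum>k. a k * w ^ k)"
  have \<phi>: "\<phi> z = of_real c * z + g (1 / z)" if "norm z \<ge> B" for z
  proof -
    have "(\<lambda>k. a k * (1 / z) ^ k) sums (\<phi> z - of_real c * z)"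
      using B(2)[OF that] by (simp add: power_one_over field_simps)
    thus ?thesis by (simp add: g_def sums_unique[symmetric])
  qed
  have "summable (\<lambda>k. a k * (1 / of_real B) ^ k)"
    using B(2)[of "of_real B"] B(1) by (auto simp: power_one_over field_simps dest: sums_summable)
  hence sm: "summable (\<lambda>k. a k * w ^ k)" if "norm w < 1 / B" for w
    using that B(1) by (auto intro!: powser_inside[of a "1 / of_real B"] simp: norm_divide)
  have holg: "g holomorphic_on ball 0 (1 / B)"
  proof (rule power_series_holomorphic[where a = a])
    fix w :: complex assume "w \<in> ball 0 (1 / B)"
    thus "(\<lambda>k. a k * (w - 0) ^ k) sums g w"
      using sm[of w] by (simp add: g_def summable_sums)
  qed
  define D where "D = cball (0::complex) (1 / (2 * B))"
  have sub: "D \<subseteq> ball 0 (1 / B)" using B(1) by (auto simp: D_def field_simps)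
  have "continuous_on D (deriv g)"
    by (meson holg holomorphic_deriv holomorphic_on_imp_continuous_on holomorphic_on_subset open_ball sub)
  hence "bounded (deriv g ` D)"
    by (intro compact_imp_bounded compact_continuous_image) (auto simp: D_def)
  then obtain M where M: "M > 0" "\<And>w. w \<in> D \<Longrightarrow> norm (deriv g w) \<le> M"
    by (auto simp: bounded_pos)
  have lip: "norm (g w - g v) \<le> M * norm (w - v)" if "w \<in> D" "v \<in> D" for w v
  proof (rule field_differentiable_bound[of D g "deriv g" M])
    show "convex D" by (simp add: D_def)
    fix x assume x: "x \<in> D"
    have "(g has_field_derivative deriv g x) (at x)"
      using x sub holg holomorphic_derivI by blast
    thus "(g has_field_derivative deriv g x) (at x within D)"
      by (rule has_field_derivative_at_within)
  qed (use that M in auto)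
  define R where "R = max (2 * B) (M / c + 1)"
  have R: "R \<ge> 2 * B" "R > M / c" "R \<ge> 1" "R > 0"
    using B(1) by (auto simp: R_def)
  have inD: "1 / z \<in> D" if "norm z > R" for z
  proof -
    have "1 / norm z \<le> 1 / (2 * B)"
      using that R(1) B(1) by (intro divide_left_mono mult_pos_pos) auto
    thus ?thesis by (simp add: D_def norm_divide)
  qed
  have inj: "inj_on \<phi> {z. norm z > R}"
  proof (rule inj_onI, rule ccontr)
    fix x y assume xy: "x \<in> {z. norm z > R}" "y \<in> {z. norm z > R}" "\<phi> x = \<phi> y" "x \<noteq> y"
    have nz: "x \<noteq> 0" "y \<noteq> 0" using xy R by auto
    have "of_real c * (x - y) = g (1 / y) - g (1 / x)"
      using xy R B(1) \<phi>[of x] \<phi>[of y] by (simp add: algebra_simps)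
    hence "c * norm (x - y) = norm (g (1 / y) - g (1 / x))"
      using c by (metis abs_of_pos norm_mult norm_of_real)
    also have "\<dots> \<le> M * norm (1 / y - 1 / x)"
      using xy by (intro lip inD) auto
    also have "1 / y - 1 / x = (x - y) / (x * y)"
      using nz by (simp add: field_simps)
    also have "M * norm ((x - y) / (x * y)) = (M / (norm x * norm y)) * norm (x - y)"
      by (simp add: norm_divide norm_mult)
    finally have "c \<le> M / (norm x * norm y)"
      by (rule mult_right_le_imp_le) (use xy(4) in simp)
    hence "c * (norm x * norm y) \<le> M"
      using nz by (simp add: field_simps)
    moreover have "R * 1 < norm x * norm y"
      using xy R by (intro mult_strict_mono) auto
    hence "c * R < c * (norm x * norm y)" using c by simp
    moreover have "M < c * R" using R(2) c by (simp add: field_simps)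
    ultimately show False by linarith
  qed
  have op: "open {z::complex. norm z > R}"
    by (intro open_Collect_less continuous_intros)
  have "(\<lambda>z. of_real c * z + g (1 / z)) holomorphic_on {z. norm z > R}"
  proof (intro holomorphic_intros holomorphic_on_compose_gen[OF _ holg, unfolded o_def])
    show "(\<lambda>z. 1 / z) ` {z::complex. R < norm z} \<subseteq> ball 0 (1 / B)"
      using inD sub by blast
  qed (use R in auto)
  hence "\<phi> holomorphic_on {z. norm z > R}"
    by (rule holomorphic_transform) (use \<phi> R B(1) in auto)
  with inj op R(4) show ?thesis
    by (auto simp: analytic_on_open)
qed

end

theory Submission
  imports Defs
begin

text \<open>
  Put \<open>y = 1/z\<close> and \<open>B(y) = y \<phi>(1/y)\<close>, and write \<open>F\<close> for the monic Faber polynomial. As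
  \<open>\<phi>\<^sup>n - c\<^sup>n F = O(1/z)\<close>, the maximum of \<open>\<bar>c\<^sup>n F\<bar>\<close> on \<open>L\<^sub>r\<close>, and by extremality also that of
  \<open>\<bar>c\<^sup>n T\<bar>\<close>, is at most \<open>r\<^sup>n + O(1/r)\<close>. Hence \<open>H(y) = c\<^sup>n T(z)/\<phi>(z)\<^sup>n\<close>, which is holomorphic
  near \<open>y = 0\<close> with \<open>H(0) = 1\<close>, satisfies \<open>\<bar>H\<bar> \<le> 1 + O(r\<^bsup>-n-1\<^esup>)\<close> on the domain
  \<open>\<bar>y/B(y)\<bar> < 1/r\<close> and in particular on a disc of radius comparable to \<open>1/r\<close>. By the Schwarz lemma
  \<open>\<bar>H - 1\<bar> = O(r\<^bsup>-n-1\<^esup>)\<close> on the disc of half that radius, that is,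
  \<open>c\<^sup>n T - \<phi>\<^sup>n = O(1/r)\<close> and so \<open>T - F = O(1/r)\<close> on a circle \<open>\<bar>z\<bar> = const \<cdot> r\<close>. The maximum
  principle for the polynomial \<open>T - F\<close> extends this bound to the inside of the circle.
\<close>

section \<open>Existence and uniqueness of Chebyshev polynomials\<close>

definition lagrange_basis :: "complex set \<Rightarrow> complex \<Rightarrow> complex poly" where
  "lagrange_basis S x = smult (1 / (\<Prod>y\<in>S-{x}. x - y)) (\<Prod>y\<in>S-{x}. [:-y, 1:])"

lemma degree_lagrange_basis:
  assumes "finite S" "x \<in> S"
  shows "degree (lagrange_basis S x) < card S"
proof -
  have "degree (\<Prod>y\<in>S-{x}. [:-y, 1:]) \<le> (\<Sum>y\<in>S-{x}. degree [:-y, 1:])"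
    by (rule degree_prod_sum_le[OF finite_Diff[OF assms(1)], unfolded o_def])
  also have "\<dots> = card S - 1"
    using assms by simp
  also have "\<dots> < card S"
    using assms by (metis card_gt_0_iff diff_less empty_iff zero_less_one)
  finally show ?thesis
    unfolding lagrange_basis_def using degree_smult_le le_less_trans by blast
qed

lemma poly_lagrange_basis:
  assumes "finite S" "x \<in> S" "z \<in> S"
  shows "poly (lagrange_basis S x) z = (if z = x then 1 else 0)"
  using assms by (auto simp: lagrange_basis_def poly_prod)

definition lagrange_interpolation :: "complex set \<Rightarrow> (complex \<Rightarrow> complex) \<Rightarrow> complex poly" where
  "lagrange_interpolation S f = (\<Sum>x\<in>S. smult (f x) (lagrange_basis S x))"

lemma degree_lagrange_interpolation:
  assumes "finite S" "S \<noteq> {}"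
  shows "degree (lagrange_interpolation S f) < card S"
  unfolding lagrange_interpolation_def using assms
  by (intro degree_sum_less) (auto intro: le_less_trans[OF degree_smult_le] degree_lagrange_basis
      simp: card_gt_0_iff)

lemma poly_lagrange_interpolation:
  assumes "finite S" "z \<in> S"
  shows "poly (lagrange_interpolation S f) z = f z"
proof -
  have "poly (lagrange_interpolation S f) z = (\<Sum>x\<in>S. if z = x then f x else 0)"
    unfolding lagrange_interpolation_def poly_sum
    by (intro sum.cong) (use assms in \<open>auto simp: poly_lagrange_basis\<close>)
  also have "\<dots> = f z"
    using assms by simp
  finally show ?thesis .
qed

lemma poly_eq_of_eq_on_card:
  fixes p q :: "complex poly"
  assumes "finite S" "degree p < card S" "degree q < card S" "\<And>z. z \<in> S \<Longrightarrow> poly p z = poly q z"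
  shows "p = q"
proof (rule ccontr)
  assume "p \<noteq> q"
  hence nz: "p - q \<noteq> 0" by simp
  have "card S \<le> card {z. poly (p - q) z = 0}"
    using assms by (intro card_mono poly_roots_finite nz) auto
  also have "\<dots> \<le> degree (p - q)"
    using card_poly_roots_bound[OF nz] .
  also have "\<dots> < card S"
    using degree_diff_le_max[of p q] assms by linarith
  finally show False by simp
qed

text \<open>\<open>p\<close> is its own interpolant on \<open>S\<close>, so its coefficients depend
  linearly on its values there. This turns a bound on the maximum norm into bounds on the
  coefficients, as needed for compactness.\<close>

lemma coeff_bound_on_finite:
  assumes "finite S" "degree p < card S" "\<And>z. z \<in> S \<Longrightarrow> norm (poly p z) \<le> \<mu>" "0 \<le> \<mu>"
  shows "norm (coeff p i) \<le> \<mu> * (\<Sum>x\<in>S. norm (coeff (lagrange_basis S x) i))"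
proof -
  have "S \<noteq> {}" using assms(2) by auto
  have "p = lagrange_interpolation S (poly p)"
    using assms \<open>S \<noteq> {}\<close>
    by (intro poly_eq_of_eq_on_card[OF assms(1)])
       (auto simp: degree_lagrange_interpolation poly_lagrange_interpolation)
  hence "coeff p i = (\<Sum>x\<in>S. poly p x * coeff (lagrange_basis S x) i)"
    by (metis (no_types, lifting) coeff_smult coeff_sum lagrange_interpolation_def sum.cong)
  also have "norm \<dots> \<le> (\<Sum>x\<in>S. \<mu> * norm (coeff (lagrange_basis S x) i))"
    by (intro sum_norm_le) (use assms in \<open>auto simp: norm_mult intro!: mult_right_mono\<close>)
  finally show ?thesis by (simp add: sum_distrib_left)
qed

section \<open>The maximum norm on a compact set\<close>

lemma norm_poly_le_max_norm_on:
  assumes "compact K" "z \<in> K"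
  shows "norm (poly p z) \<le> max_norm_on K p"
  unfolding max_norm_on_def
proof (rule cSUP_upper[OF assms(2)])
  have "compact ((\<lambda>z. norm (poly p z)) ` K)"
    by (intro compact_continuous_image continuous_intros assms)
  thus "bdd_above ((\<lambda>z. norm (poly p z)) ` K)"
    by (intro bounded_imp_bdd_above compact_imp_bounded)
qed

lemma max_norm_on_le:
  assumes "K \<noteq> {}" "\<And>z. z \<in> K \<Longrightarrow> norm (poly p z) \<le> \<mu>"
  shows "max_norm_on K p \<le> \<mu>"
  unfolding max_norm_on_def using assms by (intro cSUP_least)

lemma max_norm_on_nonneg:
  assumes "compact K" "K \<noteq> {}"
  shows "0 \<le> max_norm_on K p"
proof -
  obtain z where "z \<in> K" using assms(2) by blast
  thus ?thesis
    using norm_poly_le_max_norm_on[OF assms(1), of z p] norm_ge_zero[of "poly p z"] by linarith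
qed

lemma max_norm_on_attained:
  assumes "compact K" "K \<noteq> {}"
  obtains z where "z \<in> K" "max_norm_on K p = norm (poly p z)"
proof -
  have "continuous_on K (\<lambda>z. norm (poly p z))"
    by (intro continuous_intros)
  then obtain z where "z \<in> K" "\<forall>w\<in>K. norm (poly p w) \<le> norm (poly p z)"
    using continuous_attains_sup[OF assms] by blast
  thus ?thesis
    using assms by (intro that[of z] antisym max_norm_on_le norm_poly_le_max_norm_on) auto
qed

section \<open>Existence by compactness of coefficient sequences\<close>

lemma monic_of_degree_monom: "monic_of_degree n (monom 1 n)"
  by (simp add: monic_of_degree_def degree_monom_eq)

lemma monic_of_degree_iff: "monic_of_degree n p \<longleftrightarrow> degree p \<le> n \<and> coeff p n = 1"
  using le_degree[of p n] by (auto simp: monic_of_degree_def)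

text \<open>Tychonoff's theorem. Coefficients are treated as points of the product space
  \<open>nat \<Rightarrow> complex\<close>.\<close>

lemma compact_bounded_sequences: "compact (PiE UNIV (\<lambda>i::nat. cball (0::complex) (b i)))"
proof -
  have "compactin (product_topology (\<lambda>_. euclidean) UNIV) (PiE UNIV (\<lambda>i. cball (0::complex) (b i)))"
    by (simp add: compactin_PiE)
  thus ?thesis by (simp add: euclidean_product_topology)
qed

text \<open>With \<open>m\<close> the infimum of the norms, the closed sets \<open>A \<mu>\<close>
  for \<open>\<mu> > m\<close> shrink as \<open>\<mu>\<close> decreases to \<open>m\<close>, and
  finitely many of them always meet the compact box \<open>C\<close>. A common point of all of them
  is the coefficient sequence of a minimizer.\<close>

lemma chebyshev_poly_exists:
  assumes K: "compact K" "infinite K"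
  shows "\<exists>p. is_chebyshev_poly n K p"
proof -
  have ne: "K \<noteq> {}" using K by auto
  define m where "m = (INF q\<in>Collect (monic_of_degree n). max_norm_on K q)"
  have bdd: "bdd_below (max_norm_on K ` Collect (monic_of_degree n))"
    using max_norm_on_nonneg[OF K(1) ne] by (intro bdd_belowI2)
  have nonempty: "Collect (monic_of_degree n) \<noteq> {}"
    using monic_of_degree_monom by blast
  have m_le: "m \<le> max_norm_on K q" if "monic_of_degree n q" for q
    unfolding m_def using that by (intro cINF_lower bdd) auto
  have m_ge: "0 \<le> m"
    unfolding m_def using nonempty by (intro cINF_greatest max_norm_on_nonneg K ne)
  \<comment> \<open>\<open>Suc n\<close> nodes determine a polynomial of degree at most
    \<open>n\<close>. The level \<open>m + 1\<close> in \<open>b\<close> lets one box serve all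
    \<open>\<mu> \<le> m + 1\<close>.\<close>
  obtain S where S: "S \<subseteq> K" "finite S" "card S = Suc n"
    using K(2) infinite_arbitrarily_large by blast
  define b where "b i = (m + 1) * (\<Sum>x\<in>S. norm (coeff (lagrange_basis S x) i))" for i
  define ev where "ev f z = (\<Sum>i\<le>n. f i * z ^ i)" for f :: "nat \<Rightarrow> complex" and z
  define A where "A \<mu> = {f. f n = 1 \<and> (\<forall>z\<in>K. norm (ev f z) \<le> \<mu>)}" for \<mu>
  define C where "C = PiE UNIV (\<lambda>i. cball (0::complex) (b i))"
  have closedA: "closed (A \<mu>)" for \<mu>
  proof -
    have "continuous_on UNIV (\<lambda>f::nat \<Rightarrow> complex. f i)" for i
      by (rule continuous_on_product_coordinates)
    hence "closed {f. f n = (1::complex)}" and "\<forall>z. closed {f. norm (ev f z) \<le> \<mu>}"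
      unfolding ev_def by (auto intro!: closed_Collect_eq closed_Collect_le continuous_intros)
    hence "closed ({f. f n = (1::complex)} \<inter> (\<Inter>z\<in>K. {f. norm (ev f z) \<le> \<mu>}))"
      by (intro closed_Int closed_INT) auto
    also have "{f. f n = (1::complex)} \<inter> (\<Inter>z\<in>K. {f. norm (ev f z) \<le> \<mu>}) = A \<mu>"
      by (auto simp: A_def)
    finally show ?thesis .
  qed
  have "C \<inter> (\<Inter>\<mu>\<in>{m<..m+1}. A \<mu>) \<noteq> {}"
  proof (rule compact_imp_fip_image)
    show "compact C"
      unfolding C_def by (rule compact_bounded_sequences)
    show "closed (A \<mu>)" for \<mu> by (rule closedA)
    fix I assume I: "finite I" "I \<subseteq> {m<..m+1}"
    \<comment> \<open>Inserting \<open>m+1\<close> covers the case that \<open>I\<close> is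
      empty.\<close>
    define \<mu> where "\<mu> = Min (insert (m+1) I)"
    have \<mu>: "m < \<mu>" "\<mu> \<le> m + 1" "\<And>\<nu>. \<nu> \<in> I \<Longrightarrow> \<mu> \<le> \<nu>"
      using I by (auto simp: \<mu>_def)
    obtain q where q: "monic_of_degree n q" "max_norm_on K q < \<mu>"
      using \<mu>(1) cINF_less_iff[OF nonempty bdd] unfolding m_def by auto
    have q_le: "norm (poly q z) \<le> \<mu>" if "z \<in> K" for z
      using norm_poly_le_max_norm_on[OF K(1) that, of q] q(2) by linarith
    have "norm (coeff q i) \<le> b i" for i
      unfolding b_def
    proof (rule coeff_bound_on_finite)
      show "norm (poly q z) \<le> m + 1" if "z \<in> S" for z
        using q_le[of z] that S(1) \<mu>(2) by fastforce
    qed (use q(1) S m_ge in \<open>auto simp: monic_of_degree_def\<close>)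
    moreover have "ev (coeff q) z = poly q z" for z
      using q(1) by (auto simp: ev_def poly_altdef monic_of_degree_def)
    ultimately have "coeff q \<in> C \<inter> (\<Inter>\<mu>\<in>I. A \<mu>)"
      using q(1) q_le \<mu>(3) by (force simp: C_def A_def monic_of_degree_iff)
    thus "C \<inter> (\<Inter>\<mu>\<in>I. A \<mu>) \<noteq> {}" by blast
  qed
  then obtain f where f: "\<And>\<mu>. m < \<mu> \<Longrightarrow> \<mu> \<le> m + 1 \<Longrightarrow> f \<in> A \<mu>" by fastforce
  \<comment> \<open>Entries of \<open>f\<close> beyond \<open>n\<close> are cut off;
    \<open>ev\<close> does not see them.\<close>
  define p where "p = (\<Sum>i\<le>n. monom (f i) i)"
  have coeff_p: "coeff p i = (if i \<le> n then f i else 0)" for i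
    by (auto simp: p_def coeff_sum)
  have monic: "monic_of_degree n p"
    using f[of "m + 1"] by (auto simp: monic_of_degree_iff coeff_p A_def intro!: degree_le)
  have "poly p z = ev f z" for z
    by (simp add: p_def poly_sum poly_monom ev_def)
  hence "max_norm_on K p \<le> \<mu>" if "m < \<mu>" "\<mu> \<le> m + 1" for \<mu>
    using f[OF that] by (intro max_norm_on_le ne) (auto simp: A_def)
  hence "max_norm_on K p \<le> m"
    by (intro dense_ge_bounded[of m "m + 1"]) auto
  thus ?thesis
    using monic m_le unfolding is_chebyshev_poly_def by (meson order_trans)
qed

text \<open>If the maximum were attained at no more than \<open>n\<close> points, subtracting a small multiple of the
  polynomial of degree \<open>< n\<close> interpolating \<open>p\<close> there would decrease the norm.\<close>

lemma chebyshev_poly_extremal_points: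
  assumes K: "compact K" "infinite K" and p: "is_chebyshev_poly n K p"
    and X: "X = {z\<in>K. norm (poly p z) = max_norm_on K p}" and fin: "finite X"
  shows "n < card X"
proof (rule ccontr)
  assume card: "\<not> n < card X"
  have ne: "K \<noteq> {}" using K by auto
  define m where "m = max_norm_on K p"
  have le_m: "norm (poly p z) \<le> m" if "z \<in> K" for z
    using that norm_poly_le_max_norm_on K by (auto simp: m_def)
  obtain x where "x \<in> K" "max_norm_on K p = norm (poly p x)"
    using max_norm_on_attained[OF K(1) ne] .
  hence "X \<noteq> {}" by (auto simp: X)
  \<comment> \<open>Otherwise \<open>p\<close> vanishes on \<open>K\<close>, and
    \<open>X = K\<close> would be infinite.\<close>
  have "m > 0"
  proof (rule ccontr)
    assume "\<not> m > 0"
    hence "norm (poly p z) = m" if "z \<in> K" for z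
      using le_m[OF that] norm_ge_zero[of "poly p z"] by linarith
    hence "X = K" by (auto simp: X m_def)
    thus False using fin K by simp
  qed
  define q where "q = lagrange_interpolation X (poly p)"
  have deg_q: "degree q < n"
    using degree_lagrange_interpolation[OF fin \<open>X \<noteq> {}\<close>, of "poly p"] card
    unfolding q_def by linarith
  have q_eq: "poly q z = poly p z" if "z \<in> X" for z
    using that fin by (simp add: q_def poly_lagrange_interpolation)
  \<comment> \<open>Inside \<open>U\<close> the interpolant is close enough to \<open>p\<close> for
    the subtraction to shrink the value. Outside \<open>U\<close>, compactness leaves a gap below
    \<open>m\<close>, which a small multiple of \<open>q\<close> cannot fill.\<close>
  define U where "U = {z. norm (poly q z - poly p z) < m / 2}"
  have "open U"
    unfolding U_def by (intro open_Collect_less continuous_intros)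
  have "X \<subseteq> U" using q_eq \<open>m > 0\<close> by (auto simp: U_def)
  have "\<exists>m'<m. \<forall>z\<in>K - U. norm (poly p z) \<le> m'"
  proof (cases "K - U = {}")
    case True
    thus ?thesis by (intro exI[of _ "m - 1"]) auto
  next
    case False
    have "continuous_on (K - U) (\<lambda>z. norm (poly p z))"
      by (intro continuous_intros)
    then obtain w where w: "w \<in> K - U" "\<forall>z\<in>K - U. norm (poly p z) \<le> norm (poly p w)"
      using continuous_attains_sup[OF compact_diff[OF K(1) \<open>open U\<close>] False] by blast
    have "norm (poly p w) \<noteq> m" using w(1) \<open>X \<subseteq> U\<close> by (auto simp: X m_def)
    hence "norm (poly p w) < m" using le_m[of w] w(1) by force
    thus ?thesis using w(2) by blast
  qed
  then obtain m' where m': "m' < m" "\<And>z. z \<in> K - U \<Longrightarrow> norm (poly p z) \<le> m'" by blast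
  define N where "N = max_norm_on K q"
  have "N \<ge> 0" unfolding N_def by (intro max_norm_on_nonneg K ne)
  \<comment> \<open>Chosen so that \<open>e * N\<close> stays below the gap \<open>m - m'\<close>;
    \<open>N + 1\<close> keeps the denominator positive when \<open>N = 0\<close>.\<close>
  define e where "e = min (1/2) ((m - m') / (2 * (N + 1)))"
  have e: "0 < e" "e \<le> 1/2" "e * N < m - m'"
  proof -
    show "0 < e" using m' \<open>N \<ge> 0\<close> by (auto simp: e_def)
    show "e \<le> 1/2" unfolding e_def by (rule min.cobounded1)
    have "e * N \<le> (m - m') / (2 * (N + 1)) * N"
      using \<open>N \<ge> 0\<close> by (intro mult_right_mono) (auto simp: e_def)
    also have "\<dots> = (m - m') * (N / (2 * (N + 1)))" by simp
    also have "\<dots> < (m - m') * 1"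
      using m' \<open>N \<ge> 0\<close> by (intro mult_strict_left_mono) (auto simp: divide_less_eq)
    finally show "e * N < m - m'" by simp
  qed
  define s where "s = p - smult (of_real e) q"
  have "monic_of_degree n s"
  proof -
    have "coeff q n = 0" using deg_q coeff_eq_0 by blast
    moreover have "degree s \<le> n"
      unfolding s_def using p deg_q
      by (intro degree_diff_le order_trans[OF degree_smult_le])
         (auto simp: is_chebyshev_poly_def monic_of_degree_def)
    ultimately show ?thesis
      using p by (simp add: monic_of_degree_iff is_chebyshev_poly_def s_def)
  qed
  hence m_le: "m \<le> max_norm_on K s"
    using p by (simp add: is_chebyshev_poly_def m_def)
  obtain z where z: "z \<in> K" "max_norm_on K s = norm (poly s z)"
    using max_norm_on_attained[OF K(1) ne] .
  have "norm (poly s z) < m"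
  proof (cases "z \<in> U")
    case True
    \<comment> \<open>A multiple of \<open>p\<close> of modulus at most \<open>(1 - e) * m\<close>,
      with a perturbation of modulus less than \<open>e * m\<close>.\<close>
    have "poly s z = of_real (1 - e) * poly p z - of_real e * (poly q z - poly p z)"
      by (simp add: s_def algebra_simps)
    hence "norm (poly s z) \<le> (1 - e) * norm (poly p z) + e * norm (poly q z - poly p z)"
      using e norm_triangle_ineq4[of "of_real (1 - e) * poly p z" "of_real e * (poly q z - poly p z)"]
      by (simp add: norm_mult del: of_real_diff)
    also have "\<dots> < (1 - e) * m + e * m"
      using e True le_m[OF z(1)] \<open>m > 0\<close>
      by (intro add_le_less_mono mult_left_mono mult_strict_left_mono) (auto simp: U_def)
    finally show ?thesis by (simp add: algebra_simps)
  next
    case False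
    have "norm (poly s z) \<le> norm (poly p z) + e * norm (poly q z)"
      using e norm_triangle_ineq4[of "poly p z" "of_real e * poly q z"]
      by (simp add: s_def norm_mult)
    also have "\<dots> \<le> m' + e * N"
      using e z(1) False m'(2) norm_poly_le_max_norm_on[OF K(1) z(1)]
      by (intro add_mono mult_left_mono) (auto simp: N_def)
    finally show ?thesis using e by linarith
  qed
  thus False using z m_le by simp
qed

section \<open>Uniqueness by strict convexity\<close>

text \<open>Parallelogram law: a midpoint of full modulus leaves no room for
  \<open>x - y\<close>.\<close>

lemma eq_of_norm_midpoint:
  fixes x y :: complex
  assumes "norm x \<le> m" "norm y \<le> m" "norm ((x + y) / 2) = m"
  shows "x = y"
proof -
  have "norm (x + y) ^ 2 + norm (x - y) ^ 2 = 2 * norm x ^ 2 + 2 * norm y ^ 2"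
    unfolding cmod_power2 by (simp add: power2_eq_square algebra_simps)
  moreover have "norm (x + y) = 2 * m" using assms(3) by (simp add: norm_divide)
  hence "norm (x + y) ^ 2 = 4 * m ^ 2" by (simp add: power_mult_distrib)
  moreover have "norm x ^ 2 \<le> m ^ 2" "norm y ^ 2 \<le> m ^ 2" using assms by (auto intro: power_mono)
  ultimately have "norm (x - y) ^ 2 \<le> 0" by linarith
  thus ?thesis by simp
qed

text \<open>The average \<open>s\<close> of two minimizers is a minimizer too. Where
  \<open>s\<close> attains its maximum, strict convexity forces \<open>p\<close> and
  \<open>q\<close> to agree, and there are more than \<open>n\<close> such points.\<close>

lemma chebyshev_poly_unique:
  assumes K: "compact K" "infinite K" and p: "is_chebyshev_poly n K p" and q: "is_chebyshev_poly n K q"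
  shows "p = q"
proof -
  have ne: "K \<noteq> {}" using K by auto
  define m where "m = max_norm_on K p"
  have mq: "max_norm_on K q = m"
    using p q unfolding is_chebyshev_poly_def m_def by (meson antisym)
  have p_le: "norm (poly p z) \<le> m" and q_le: "norm (poly q z) \<le> m" if "z \<in> K" for z
    using norm_poly_le_max_norm_on[OF K(1) that] mq by (metis m_def)+
  have mono: "monic_of_degree n p" "monic_of_degree n q"
    using p q by (auto simp: is_chebyshev_poly_def)
  define s where "s = smult (1/2) (p + q)"
  have poly_s: "poly s z = (poly p z + poly q z) / 2" for z by (simp add: s_def)
  have monic_s: "monic_of_degree n s"
    using mono by (auto simp: s_def monic_of_degree_iff degree_add_le)
  have "max_norm_on K s \<le> m"
  proof (rule max_norm_on_le[OF ne])
    fix z assume "z \<in> K"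
    thus "norm (poly s z) \<le> m"
      using norm_triangle_ineq[of "poly p z" "poly q z"] p_le q_le
      by (fastforce simp: poly_s norm_divide)
  qed
  moreover have "m \<le> max_norm_on K s"
    using p monic_s by (simp add: is_chebyshev_poly_def m_def)
  ultimately have ms: "max_norm_on K s = m" by simp
  have cheb_s: "is_chebyshev_poly n K s"
    using monic_s p ms by (simp add: is_chebyshev_poly_def m_def)
  define X where "X = {z\<in>K. norm (poly s z) = max_norm_on K s}"
  have eq: "poly p z = poly q z" if "z \<in> X" for z
    using that p_le q_le by (intro eq_of_norm_midpoint[where m = m]) (auto simp: X_def ms poly_s)
  obtain Y where Y: "Y \<subseteq> X" "finite Y" "n < card Y"
  proof (cases "finite X")
    case True
    thus ?thesis using chebyshev_poly_extremal_points[OF K cheb_s X_def] that by blast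
  next
    case False
    then obtain Y where "Y \<subseteq> X" "finite Y" "card Y = Suc n"
      using infinite_arbitrarily_large by blast
    thus ?thesis using that by simp
  qed
  show ?thesis
    using Y eq mono by (intro poly_eq_of_eq_on_card[of Y]) (auto simp: monic_of_degree_def)
qed

lemma is_chebyshev_poly_chebyshev_poly:
  assumes "compact K" "infinite K"
  shows "is_chebyshev_poly n K (chebyshev_poly n K)"
  unfolding chebyshev_poly_def
proof (rule theI')
  show "\<exists>!p. is_chebyshev_poly n K p"
    using chebyshev_poly_exists[OF assms] chebyshev_poly_unique[OF assms] by (rule ex_ex1I)
qed

section \<open>Comparison with Faber polynomials\<close>

text \<open>Removing the polynomial part cancels all coefficients of index at most 0 in
  \<open>w = 1/z\<close>, so the difference divided by \<open>w\<close> has a finite limit at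
  0.\<close>

lemma polynomial_part_at_infinity_remainder:
  assumes "(\<lambda>w. f (1 / w)) has_laurent_expansion L"
  shows "\<exists>C>0. \<forall>\<^sub>F w in at 0. norm (f (1 / w) - poly (polynomial_part_at_infinity f) (1 / w)) \<le> C * norm w"
proof -
  define P where "P = polynomial_part_at_infinity f"
  have "laurent_expansion_at_infinity f = L"
    unfolding laurent_expansion_at_infinity_def by (rule laurent_expansion_0_eqI[OF assms])
  hence coeff_P: "coeff P i = fls_nth L (- int i)" for i
    by (cases i) (simp_all add: P_def polynomial_part_at_infinity_def Let_def coeff_pCons)
  define D where "D = L - (\<Sum>i\<le>degree P. fls_const (coeff P i) * fls_X_inv ^ i)"
  have D: "(\<lambda>w. f (1 / w) - poly P (1 / w)) has_laurent_expansion D"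
    unfolding D_def poly_altdef inverse_eq_divide[symmetric]
    using assms by (intro laurent_expansion_intros) (simp_all add: inverse_eq_divide)
  have "fls_nth D k = 0" if "k \<le> 0" for k
  proof -
    define j where "j = nat (- k)"
    have j: "k = - int j" using that by (simp add: j_def)
    have "fls_nth (\<Sum>i\<le>degree P. fls_const (coeff P i) * fls_X_inv ^ i) k
        = (\<Sum>i\<le>degree P. if i = j then coeff P j else 0)"
      unfolding fls_nth_sum by (intro sum.cong) (auto simp: j)
    also have "\<dots> = coeff P j"
      by (auto simp: coeff_eq_0)
    finally show ?thesis by (simp add: D_def coeff_P j)
  qed
  hence sub: "fls_subdegree (fls_shift 1 D) \<ge> 0"
    by (intro fls_subdegree_ge0I) simp
  \<comment> \<open>The shift by 1 is division by \<open>w\<close>.\<close>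
  have "(\<lambda>w. (f (1 / w) - poly P (1 / w)) * w powi (-1)) has_laurent_expansion fls_shift 1 D"
    by (rule has_laurent_expansion_shift'[OF D])
  note lim = has_laurent_expansion_imp_tendsto_0[OF this sub]
  have "\<forall>\<^sub>F w in at 0. norm ((f (1 / w) - poly P (1 / w)) * w powi (-1))
      < norm (fls_nth (fls_shift 1 D) 0) + 1"
    by (rule order_tendstoD(2)[OF tendsto_norm[OF lim]]) simp
  moreover define C where "C = norm (fls_nth (fls_shift 1 D) 0) + 1"
  ultimately have C: "C > 0"
    "\<forall>\<^sub>F w in at 0. norm ((f (1 / w) - poly P (1 / w)) * w powi (-1)) < C"
    by (auto simp: add_nonneg_pos)
  have "\<forall>\<^sub>F w in at 0. norm (f (1 / w) - poly P (1 / w)) \<le> C * norm w"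
    using C(2) eventually_neq_at_within[of 0]
    by eventually_elim (auto simp: norm_mult norm_divide field_simps)
  thus ?thesis using C(1) unfolding P_def by blast
qed

text \<open>The Schwarz lemma applies to \<open>(f - 1) / (2 M - 1 - f)\<close> because \<open>2 M - 1\<close> is the mirror image
  of \<open>f 0 = 1\<close> in the line \<open>Re w = M\<close>.\<close>

lemma norm_minus_one_le_of_norm_less:
  assumes "f holomorphic_on ball 0 s" "f 0 = 1" "\<And>y. norm y < s \<Longrightarrow> norm (f y) < M"
    and y: "norm y \<le> s / 2" and "s > 0"
  shows "norm (f y - 1) \<le> 2 * (M - 1)"
proof -
  \<comment> \<open>The disc is rescaled to the unit disc, and a Moebius map takes the half-plane
    \<open>Re w < M\<close> to the unit disc with \<open>1\<close> going to
    \<open>0\<close>.\<close>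
  define g where "g u = (f (of_real s * u) - 1) / (of_real (2 * M - 1) - f (of_real s * u))" for u
  have bd: "norm (f (of_real s * u)) < M" if "norm u < 1" for u
    using that \<open>s > 0\<close> by (intro assms(3)) (simp add: norm_mult)
  have M: "M > 1" using assms(3)[of 0] \<open>s > 0\<close> assms(2) by simp
  have lt: "norm (w - 1) < norm (of_real (2 * M - 1) - w)" if "norm w < M" for w :: complex
  proof -
    have "Re w < M" using that complex_Re_le_cmod[of w] by linarith
    \<comment> \<open>Points with \<open>Re w < M\<close> are closer to \<open>1\<close> than to its
      mirror image.\<close>
    have "norm (of_real (2 * M - 1) - w) ^ 2 - norm (w - 1) ^ 2 = 4 * (M - 1) * (M - Re w)"
      unfolding cmod_power2 by (simp add: power2_eq_square algebra_simps)
    also have "\<dots> > 0" using M \<open>Re w < M\<close> by simp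
    finally show ?thesis by (simp add: power2_less_imp_less)
  qed
  define u where "u = y / of_real s"
  have u: "norm u \<le> 1 / 2" using y \<open>s > 0\<close> by (simp add: u_def norm_divide field_simps)
  have "norm (g u) \<le> norm u"
  proof (rule Schwarz_Lemma(1))
    show "g 0 = 0" using assms(2) by (simp add: g_def)
    show "norm (g v) < 1" if "norm v < 1" for v
    proof -
      have "norm (f (of_real s * v) - 1) < norm (of_real (2 * M - 1) - f (of_real s * v))"
        using lt[OF bd[OF that]] .
      thus ?thesis unfolding g_def norm_divide by (subst divide_less_eq_1_pos) (auto intro: le_less_trans[OF norm_ge_zero])
    qed
    have "(\<lambda>v. f (of_real s * v)) holomorphic_on ball 0 1"
      using \<open>s > 0\<close>
      by (intro holomorphic_on_compose_gen[OF _ assms(1), unfolded o_def] holomorphic_intros)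
         (auto simp: norm_mult)
    moreover have "of_real (2 * M - 1) - f (of_real s * v) \<noteq> 0" if "v \<in> ball 0 1" for v
      using lt[OF bd[of v]] that by fastforce
    ultimately show "g holomorphic_on ball 0 1"
      unfolding g_def by (intro holomorphic_intros) auto
  qed (use u in simp)
  moreover have "of_real s * u = y" using \<open>s > 0\<close> by (simp add: u_def)
  moreover have "norm (f y - 1) < norm (of_real (2 * M - 1) - f y)"
    using y \<open>s > 0\<close> by (intro lt assms(3)) simp
  hence pos: "0 < norm (of_real (2 * M - 1) - f y)"
    by (rule le_less_trans[OF norm_ge_zero])
  ultimately have "norm (f y - 1) \<le> norm u * norm (of_real (2 * M - 1) - f y)"
    by (simp add: g_def norm_divide pos_divide_le_eq del: of_real_diff)
  also have "\<dots> \<le> 1 / 2 * norm (of_real (2 * M - 1) - f y)"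
    using u by (intro mult_right_mono) auto
  \<comment> \<open>Half of \<open>norm (f y - 1)\<close> reappears on the right and is absorbed at
    the end.\<close>
  also have "of_real (2 * M - 1) - f y = of_real (2 * (M - 1)) - (f y - 1)" by simp
  also have "norm \<dots> \<le> 2 * (M - 1) + norm (f y - 1)"
    using M norm_triangle_ineq4[of "of_real (2 * (M - 1))" "f y - 1"]
    by (simp only: norm_of_real) simp
  finally show ?thesis by simp
qed

section \<open>The map and its level curves near infinity\<close>

text \<open>The radius \<open>\<rho>\<close> in the variable \<open>1/z\<close> is so small that
  \<open>B\<close> stays within a factor 2 of \<open>c\<close>, hence \<open>\<phi> z\<close> is
  comparable to \<open>c * z\<close> beyond \<open>1 / \<rho>\<close>. Injectivity is kept on the
  larger region beyond \<open>R\<close>, because \<open>level_curve\<close> is taken there.\<close>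

locale univalent_at_infinity =
  fixes \<phi> B :: "complex \<Rightarrow> complex" and c R \<rho> :: real
  assumes c: "c > 0" and R: "R > 0" and \<rho>: "\<rho> > 0" and R_le: "R \<le> 1 / \<rho>"
    and hol_B: "B holomorphic_on ball 0 \<rho>" and B_0: "B 0 = of_real c"
    and B_bounds: "\<And>y. norm y < \<rho> \<Longrightarrow> c / 2 \<le> norm (B y) \<and> norm (B y) \<le> 2 * c"
    and \<phi>_eq: "\<And>z. norm z > 1 / \<rho> \<Longrightarrow> \<phi> z = z * B (1 / z)"
    and inj: "inj_on \<phi> {z. norm z > R}"
begin

lemma norm_inverse_less:
  fixes z :: complex
  assumes "norm z > 1 / \<rho>"
  shows "norm (1 / z) < \<rho>" "z \<noteq> 0"
proof -
  have "0 < 1 / \<rho>" using \<rho> by simp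
  hence "norm z > 0" using assms by linarith
  thus "z \<noteq> 0" by simp
  thus "norm (1 / z) < \<rho>" using assms \<rho> by (simp add: norm_divide field_simps)
qed

lemma norm_inverse_greater:
  fixes y :: complex
  assumes "norm y < \<rho>" "y \<noteq> 0"
  shows "norm (1 / y) > 1 / \<rho>"
  using assms \<rho> by (simp add: norm_divide field_simps)

lemma B_nonzero: "norm y < \<rho> \<Longrightarrow> B y \<noteq> 0"
  using B_bounds[of y] c by auto

lemma norm_\<phi>_bounds:
  assumes "norm z > 1 / \<rho>"
  shows "norm (\<phi> z) \<le> 2 * c * norm z" "norm z \<le> 2 * norm (\<phi> z) / c"
proof -
  have *: "norm (\<phi> z) = norm z * norm (B (1 / z))"
    using \<phi>_eq[OF assms] by (simp add: norm_mult)
  note b = B_bounds[OF norm_inverse_less(1)[OF assms]]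
  show "norm (\<phi> z) \<le> 2 * c * norm z"
    unfolding * using b by (simp add: mult.commute mult_left_mono)
  have "norm z * (c / 2) \<le> norm (\<phi> z)"
    unfolding * using b by (intro mult_left_mono) auto
  thus "norm z \<le> 2 * norm (\<phi> z) / c"
    using c by (simp add: field_simps)
qed

text \<open>Open mapping theorem for \<open>h y = y / B y\<close>, which is
  \<open>1 / \<phi> (1 / y)\<close> for \<open>y \<noteq> 0\<close> and has
  \<open>h 0 = 0\<close>.\<close>

lemma range_contains_neighbourhood_of_infinity:
  "\<exists>r0>0. \<forall>w. norm w > r0 \<longrightarrow> (\<exists>z. norm z > 1 / \<rho> \<and> \<phi> z = w)"
proof -
  define h where "h y = y / B y" for y
  have hol_h: "h holomorphic_on ball 0 \<rho>"
    unfolding h_def using B_nonzero by (intro holomorphic_intros hol_B) auto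
  have "\<not> h constant_on ball 0 \<rho>"
  proof
    assume "h constant_on ball 0 \<rho>"
    hence "h (of_real (\<rho> / 2)) = h 0"
      using \<rho> unfolding constant_on_def by fastforce
    thus False using B_nonzero[of "of_real (\<rho> / 2)"] \<rho> by (simp add: h_def)
  qed
  hence "open (h ` ball 0 \<rho>)"
    by (intro open_mapping_thm[OF hol_h]) auto
  moreover have "0 \<in> h ` ball 0 \<rho>"
    using \<rho> by (intro image_eqI[of _ _ 0]) (auto simp: h_def)
  ultimately obtain e where e: "e > 0" "ball 0 e \<subseteq> h ` ball 0 \<rho>"
    using open_contains_ball by blast
  have "\<exists>z. norm z > 1 / \<rho> \<and> \<phi> z = w" if w: "norm w > 1 / e" for w
  proof -
    have "0 < 1 / e" using e by simp
    hence "w \<noteq> 0" using w by auto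
    have "1 / w \<in> ball 0 e" using w \<open>w \<noteq> 0\<close> e(1) by (simp add: norm_divide field_simps)
    then obtain y where y: "norm y < \<rho>" "1 / w = y / B y" using e(2) by (auto simp: h_def)
    have "y \<noteq> 0" using y(2) \<open>w \<noteq> 0\<close> by auto
    hence "\<phi> (1 / y) = w"
      using y \<open>w \<noteq> 0\<close> B_nonzero[OF y(1)] \<phi>_eq[OF norm_inverse_greater[OF y(1)]]
      by (simp add: divide_simps)
    thus ?thesis using norm_inverse_greater[OF y(1) \<open>y \<noteq> 0\<close>] by blast
  qed
  thus ?thesis using e(1) by (intro exI[of _ "1 / e"]) auto
qed

text \<open>For large \<open>r\<close>, every value of modulus \<open>r\<close> is already taken
  beyond \<open>1 / \<rho>\<close>, so injectivity excludes further preimages between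
  \<open>R\<close> and \<open>1 / \<rho>\<close>.\<close>

lemma eventually_level_curve:
  "\<forall>\<^sub>F r in at_top. compact (level_curve \<phi> R r) \<and> infinite (level_curve \<phi> R r) \<and>
     level_curve \<phi> R r = {z. norm z > 1 / \<rho> \<and> norm (\<phi> z) = r}"
proof -
  obtain r0 where r0: "r0 > 0" "\<And>w. norm w > r0 \<Longrightarrow> \<exists>z. norm z > 1 / \<rho> \<and> \<phi> z = w"
    using range_contains_neighbourhood_of_infinity by blast
  have "compact (level_curve \<phi> R r) \<and> infinite (level_curve \<phi> R r) \<and>
     level_curve \<phi> R r = {z. norm z > 1 / \<rho> \<and> norm (\<phi> z) = r}"
    if r: "r > r0" "r > 4 * c / \<rho>" for r
  proof -
    have eq: "level_curve \<phi> R r = {z. norm z > 1 / \<rho> \<and> norm (\<phi> z) = r}"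
    proof (intro equalityI subsetI)
      fix z assume "z \<in> level_curve \<phi> R r"
      hence z: "norm z > R" "norm (\<phi> z) = r" by (auto simp: level_curve_def)
      obtain z' where z': "norm z' > 1 / \<rho>" "\<phi> z' = \<phi> z" using r0(2)[of "\<phi> z"] z r by auto
      have "z' = z" using inj_onD[OF inj z'(2)] z z' R_le by auto
      thus "z \<in> {z. norm z > 1 / \<rho> \<and> norm (\<phi> z) = r}" using z z' by simp
    qed (use R_le in \<open>auto simp: level_curve_def\<close>)
    \<comment> \<open>A compact annulus inside the region where \<open>\<phi>\<close> is known to be
      continuous. The outer radius comes from the lower bound on \<open>\<phi>\<close>, and the
      inner one from \<open>r > 4 * c / \<rho>\<close> and the upper bound.\<close>
    define D where "D = cball 0 (2 * r / c) - ball (0::complex) (2 / \<rho>)"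
    have far: "norm z > 1 / \<rho>" if "z \<in> D" for z
    proof -
      have "norm z \<ge> 2 / \<rho>" "1 / \<rho> < 2 / \<rho>" using that \<rho> by (auto simp: D_def divide_strict_right_mono)
      thus ?thesis by linarith
    qed
    have "level_curve \<phi> R r = {z \<in> D. norm (\<phi> z) = r}"
    proof (intro equalityI subsetI)
      fix z assume "z \<in> level_curve \<phi> R r"
      hence z: "norm z > 1 / \<rho>" "norm (\<phi> z) = r" by (auto simp: eq)
      have "4 * c / \<rho> < 2 * c * norm z" using norm_\<phi>_bounds(1)[OF z(1)] z(2) r by linarith
      hence "2 / \<rho> < norm z" using c \<rho> by (simp add: field_simps)
      thus "z \<in> {z \<in> D. norm (\<phi> z) = r}"
        using z norm_\<phi>_bounds(2)[OF z(1)] by (auto simp: D_def)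
    qed (use far in \<open>auto simp: eq\<close>)
    also have "compact \<dots>"
    proof -
      have "compact D" unfolding D_def by (intro compact_diff) auto
      have "continuous_on D (\<lambda>z. z * B (1 / z))"
        using far norm_inverse_less
        by (intro continuous_intros continuous_on_compose2[OF holomorphic_on_imp_continuous_on[OF hol_B]]) auto
      hence "continuous_on D \<phi>"
        by (rule continuous_on_eq) (use far \<phi>_eq in auto)
      hence "closedin (top_of_set D) {z \<in> D. norm (\<phi> z) = r}"
        by (intro continuous_closedin_preimage_constant continuous_intros)
      thus ?thesis using \<open>compact D\<close> closedin_compact by blast
    qed
    finally have "compact (level_curve \<phi> R r)" .
    moreover have "infinite (level_curve \<phi> R r)"
    proof
      assume "finite (level_curve \<phi> R r)"
      hence "finite (\<phi> ` level_curve \<phi> R r)" by simp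
      moreover have "sphere 0 r \<subseteq> \<phi> ` level_curve \<phi> R r"
      proof
        fix w :: complex assume w: "w \<in> sphere 0 r"
        then obtain z where "norm z > 1 / \<rho>" "\<phi> z = w" using r0(2)[of w] r by auto
        thus "w \<in> \<phi> ` level_curve \<phi> R r" using w by (auto simp: eq)
      qed
      ultimately have "finite (sphere (0::complex) r)" by (rule rev_finite_subset)
      \<comment> \<open>A connected set with two distinct points is infinite.\<close>
      moreover have "infinite (sphere (0::complex) r)"
      proof -
        have "of_real r \<in> sphere (0::complex) r" "- of_real r \<in> sphere (0::complex) r"
          "of_real r \<noteq> - (of_real r :: complex)"
          using r r0(1) by (auto simp: complex_eq_iff)
        moreover have "connected (sphere (0::complex) r)" by (rule connected_sphere) simp
        ultimately show ?thesis by (metis connected_finite_iff_sing empty_iff singletonD)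
      qed
      ultimately show False by simp
    qed
    ultimately show ?thesis using eq by simp
  qed
  thus ?thesis
    using eventually_conj[OF eventually_gt_at_top[of r0] eventually_gt_at_top[of "4 * c / \<rho>"]]
    by (elim eventually_mono) blast
qed

section \<open>Faber polynomials as principal parts\<close>

text \<open>Here \<open>b\<close> is the Taylor series of \<open>B\<close> at 0, and
  \<open>\<phi> (1 / w) ^ n\<close> equals \<open>B w ^ n\<close> divided by \<open>w ^ n\<close>
  near 0.\<close>

lemma faber_poly_expansion:
  "\<exists>b. fps_nth b 0 = of_real c \<and>
    (\<lambda>w. \<phi> (1 / w) ^ n) has_laurent_expansion fls_shift (int n) (fps_to_fls (b ^ n))"
proof -
  have "B analytic_on {0}" using hol_B \<rho> by (metis analytic_at centre_in_ball open_ball)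
  then obtain b where b: "B has_fps_expansion b" using analytic_at_imp_has_fps_expansion_0 by blast
  have "fps_nth b 0 = of_real c"
    using has_fps_expansion_imp_0_eq_fps_nth_0[OF b] B_0 by simp
  moreover have "(\<lambda>w. B w ^ n * w powi (- int n)) has_laurent_expansion fls_shift (int n) (fps_to_fls (b ^ n))"
    by (intro has_laurent_expansion_shift' has_laurent_expansion_fps has_fps_expansion_power b)
  moreover have "\<forall>\<^sub>F w in at 0. B w ^ n * w powi (- int n) = \<phi> (1 / w) ^ n"
  proof -
    have "\<forall>\<^sub>F w::complex in at 0. w \<in> ball 0 \<rho> - {0}"
      using \<rho> by (intro eventually_at_in_open) auto
    thus ?thesis
    proof eventually_elim
      case (elim w)
      thus ?case
        using \<phi>_eq[OF norm_inverse_greater, of w]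
        by (simp add: power_int_minus power_divide inverse_eq_divide)
    qed
  qed
  ultimately show ?thesis
    using iffD1[OF has_laurent_expansion_cong[OF _ refl]] by (intro exI[of _ b] conjI)
qed

lemma monic_of_degree_monic_faber_poly: "monic_of_degree n (monic_faber_poly \<phi> c n)"
proof -
  obtain b where b: "fps_nth b 0 = of_real c"
    "(\<lambda>w. \<phi> (1 / w) ^ n) has_laurent_expansion fls_shift (int n) (fps_to_fls (b ^ n))"
    using faber_poly_expansion by blast
  have "laurent_expansion_at_infinity (\<lambda>z. \<phi> z ^ n) = fls_shift (int n) (fps_to_fls (b ^ n))"
    unfolding laurent_expansion_at_infinity_def by (rule laurent_expansion_0_eqI[OF b(2)])
  \<comment> \<open>The shift moves index \<open>-i\<close> to \<open>n - i\<close>, which is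
    negative for \<open>i > n\<close> and 0 for \<open>i = n\<close>.\<close>
  hence coeff: "coeff (faber_poly \<phi> n) i = fls_nth (fps_to_fls (b ^ n)) (int n - int i)" for i
    by (cases i) (simp_all add: faber_poly_def polynomial_part_at_infinity_def Let_def coeff_pCons
        algebra_simps)
  have "coeff (faber_poly \<phi> n) i = 0" if "n < i" for i
    using that by (simp add: coeff)
  moreover have "coeff (faber_poly \<phi> n) n = of_real c ^ n"
    by (simp add: coeff b(1) fps_power_zeroth)
  ultimately show ?thesis
    using c by (auto simp: monic_of_degree_iff monic_faber_poly_def intro!: degree_le)
qed

lemma monic_faber_poly_remainder:
  "\<exists>C>0. \<forall>\<^sub>F z in at_infinity.
     norm (\<phi> z ^ n - of_real c ^ n * poly (monic_faber_poly \<phi> c n) z) \<le> C / norm z"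
proof -
  obtain b where
    "(\<lambda>w. \<phi> (1 / w) ^ n) has_laurent_expansion fls_shift (int n) (fps_to_fls (b ^ n))"
    using faber_poly_expansion by blast
  from polynomial_part_at_infinity_remainder[OF this] obtain C where C: "C > 0"
    "\<forall>\<^sub>F w in at 0. norm (\<phi> (1 / w) ^ n - poly (faber_poly \<phi> n) (1 / w)) \<le> C * norm w"
    unfolding faber_poly_def by blast
  have "\<forall>\<^sub>F z in at_infinity. norm (\<phi> z ^ n - poly (faber_poly \<phi> n) z) \<le> C / norm z"
    using C(2) by (simp add: at_to_infinity eventually_filtermap inverse_eq_divide norm_divide)
  moreover have "of_real c ^ n * poly (monic_faber_poly \<phi> c n) z = poly (faber_poly \<phi> n) z" for z
    using c by (simp add: monic_faber_poly_def)
  ultimately show ?thesis using C(1) by auto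
qed

section \<open>From the level curve to a disc and a circle\<close>

text \<open>Maximum principle on \<open>D\<close>, the exterior of the level curve seen in
  \<open>y = 1/z\<close> together with \<open>y = 0\<close>: since
  \<open>\<phi> (1 / y) = B y / y\<close>, the frontier of \<open>D\<close> corresponds to points of
  the curve.\<close>

lemma norm_le_on_ball_if_level_curve_bound:
  assumes r: "r > 0" "2 * c / r < \<rho>"
    and hol: "H holomorphic_on ball 0 \<rho>"
    and bound: "\<And>z. norm z > 1 / \<rho> \<Longrightarrow> norm (\<phi> z) = r \<Longrightarrow> norm (H (1 / z)) \<le> M"
    and y: "norm y < c / (2 * r)"
  shows "norm (H y) \<le> M"
proof -
  define D where "D = {y \<in> ball 0 \<rho>. r * norm y < norm (B y)}"
  \<comment> \<open>A closed set containing \<open>D\<close>, which keeps \<open>closure D\<close>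
    inside the ball where \<open>H\<close> is holomorphic. The radius reflects
    \<open>r * norm y \<le> norm (B y) \<le> 2 * c\<close>.\<close>
  define D' where "D' = {y \<in> cball 0 (2 * c / r). r * norm y \<le> norm (B y)}"
  have cont: "continuous_on S B" if "S \<subseteq> ball 0 \<rho>" for S
    by (rule continuous_on_subset[OF holomorphic_on_imp_continuous_on[OF hol_B] that])
  have sub: "cball 0 (2 * c / r) \<subseteq> ball 0 \<rho>"
    using r(2) by auto
  have D_sub: "D \<subseteq> D'"
  proof
    fix y assume "y \<in> D"
    hence "norm y < \<rho>" "r * norm y < norm (B y)" by (auto simp: D_def)
    moreover have "r * norm y < 2 * c" using B_bounds[of y] calculation by linarith
    ultimately show "y \<in> D'" using r(1) by (auto simp: D'_def field_simps)
  qed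
  have "open D"
  proof -
    have "open (ball 0 \<rho> \<inter> (\<lambda>y. norm (B y) - r * norm y) -` {0<..})"
      by (intro continuous_open_preimage continuous_intros cont) auto
    also have "\<dots> = D" by (auto simp: D_def)
    finally show ?thesis .
  qed
  have "closed D'"
  proof -
    have "closed (cball 0 (2 * c / r) \<inter> (\<lambda>y. norm (B y) - r * norm y) -` {0..})"
      by (intro continuous_closed_preimage continuous_intros cont sub) auto
    also have "\<dots> = D'" by (auto simp: D'_def)
    finally show ?thesis .
  qed
  hence clos: "closure D \<subseteq> D'" using D_sub closure_minimal by blast
  show ?thesis
  proof (rule maximum_modulus_frontier[where S = D and f = H])
    show "H holomorphic_on interior D"
      using hol by (rule holomorphic_on_subset) (use interior_subset[of D] in \<open>auto simp: D_def\<close>)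
    have "D' \<subseteq> ball 0 \<rho>" using sub by (auto simp: D'_def)
    thus "continuous_on (closure D) H"
      using clos by (intro continuous_on_subset[OF holomorphic_on_imp_continuous_on[OF hol]]) simp
    show "bounded D" by (rule bounded_subset[of "ball 0 \<rho>"]) (auto simp: D_def)
    show "y \<in> D"
    proof -
      have ry: "r * norm y < c / 2" using y r(1) by (simp add: field_simps)
      have "c / (2 * r) \<le> 2 * c / r" using c r(1) by (simp add: field_simps)
      hence "norm y < \<rho>" using y r(2) by linarith
      thus ?thesis using ry B_bounds[of y] by (auto simp: D_def)
    qed
    fix y assume "y \<in> frontier D"
    hence "y \<in> D'" "y \<notin> D" using clos \<open>open D\<close> by (auto simp: frontier_def interior_open)
    hence y: "norm y < \<rho>" "r * norm y = norm (B y)"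
      using r(2) by (auto simp: D_def D'_def)
    have "y \<noteq> 0" using y B_nonzero[of y] by auto
    hence "norm (\<phi> (1 / y)) = r"
      using y(1) \<phi>_eq[OF norm_inverse_greater, of y] by (simp add: norm_divide y(2)[symmetric])
    thus "norm (H y) \<le> M"
      using bound[OF norm_inverse_greater, of y] y(1) \<open>y \<noteq> 0\<close> by simp
  qed
qed

lemma near_power_of_\<phi>:
  assumes r: "r > 0" "2 * c / r < \<rho>" and p: "monic_of_degree n p" and \<epsilon>: "\<epsilon> > 0"
    and bound: "\<And>z. norm z > 1 / \<rho> \<Longrightarrow> norm (\<phi> z) = r \<Longrightarrow> c ^ n * norm (poly p z) \<le> (1 + \<epsilon>) * r ^ n"
    and z: "norm z = 4 * r / c"
  shows "norm (of_real c ^ n * poly p z - \<phi> z ^ n) \<le> 4 * \<epsilon> * (8 * r) ^ n"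
proof -
  \<comment> \<open>For \<open>y = 1/z\<close> with \<open>y \<noteq> 0\<close> this is
    \<open>c^n p(z) / \<phi>(z)^n\<close>. Reversing the coefficients removes the singularity at
    \<open>y = 0\<close>, where the leading coefficient of \<open>p\<close> gives the value
    1.\<close>
  define H where "H y = of_real c ^ n * poly (reflect_poly p) y / B y ^ n" for y
  have H: "\<phi> z ^ n * H (1 / z) = of_real c ^ n * poly p z" if "norm z > 1 / \<rho>" for z
  proof -
    have "z \<noteq> 0" "B (1 / z) \<noteq> 0"
      using norm_inverse_less[OF that] B_nonzero by auto
    moreover have "degree p = n" using p by (simp add: monic_of_degree_def)
    moreover have "poly (reflect_poly p) (1 / z) = poly p z / z ^ n"
      using poly_reflect_poly_nz[of "1 / z" p] calculation by (simp add: power_divide)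
    ultimately show ?thesis
      using \<phi>_eq[OF that] by (simp add: H_def power_mult_distrib)
  qed
  have "1 / \<rho> < norm z"
  proof -
    have "2 * c < \<rho> * r" using r by (simp add: field_simps)
    hence "1 * c < 4 * r * \<rho>" using c by (simp add: mult.commute)
    thus ?thesis unfolding z using c \<rho> by (simp add: field_simps)
  qed
  have hol: "H holomorphic_on ball 0 \<rho>"
    unfolding H_def using B_nonzero
    by (intro holomorphic_intros hol_B) auto
  have le: "norm (H y) \<le> 1 + \<epsilon>" if y: "norm y < c / (2 * r)" for y
  proof (rule norm_le_on_ball_if_level_curve_bound[OF r hol _ y])
    fix z assume z: "norm z > 1 / \<rho>" "norm (\<phi> z) = r"
    have "r ^ n * norm (H (1 / z)) = c ^ n * norm (poly p z)"
      using arg_cong[OF H[OF z(1)], of norm] c by (simp add: norm_mult norm_power z(2))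
    also have "\<dots> \<le> r ^ n * (1 + \<epsilon>)" using bound[OF z] by (simp add: mult.commute)
    finally show "norm (H (1 / z)) \<le> 1 + \<epsilon>" using r(1) by simp
  qed
  \<comment> \<open>\<open>1 + 2 * \<epsilon>\<close> supplies the strict bound that the Schwarz
    estimate asks for. The circle \<open>norm z = 4 * r / c\<close> corresponds to half the radius
    \<open>c / (2 * r)\<close>.\<close>
  have "norm (H (1 / z) - 1) \<le> 2 * ((1 + 2 * \<epsilon>) - 1)"
  proof (rule norm_minus_one_le_of_norm_less[where f = H])
    show "H holomorphic_on ball 0 (c / (2 * r))"
    proof (rule holomorphic_on_subset[OF hol])
      have "c / (2 * r) \<le> 2 * c / r" using c r(1) by (simp add: field_simps)
      thus "ball 0 (c / (2 * r)) \<subseteq> ball (0::complex) \<rho>" using r(2) by auto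
    qed
    show "H 0 = 1" using p c by (auto simp: H_def B_0 monic_of_degree_def)
    show "norm (H y) < 1 + 2 * \<epsilon>" if "norm y < c / (2 * r)" for y
      using le[OF that] \<epsilon> by linarith
    show "norm (1 / z) \<le> c / (2 * r) / 2" using z by (simp add: norm_divide)
    show "c / (2 * r) > 0" using c r by simp
  qed
  moreover have "norm (\<phi> z) \<le> 8 * r"
    using norm_\<phi>_bounds(1)[OF \<open>1 / \<rho> < norm z\<close>] z c by simp
  ultimately have "norm (\<phi> z ^ n * (H (1 / z) - 1)) \<le> (8 * r) ^ n * (4 * \<epsilon>)"
    unfolding norm_mult norm_power by (intro mult_mono power_mono) (use r in auto)
  also have "\<phi> z ^ n * (H (1 / z) - 1) = of_real c ^ n * poly p z - \<phi> z ^ n"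
    using H[OF \<open>1 / \<rho> < norm z\<close>] by (simp add: algebra_simps)
  finally show ?thesis by (simp add: mult.commute)
qed

section \<open>The quantitative comparison and the limit\<close>

lemma chebyshev_poly_near_monic_faber_poly:
  "\<exists>K. \<forall>\<^sub>F r in at_top. \<forall>z. norm z \<le> 4 * r / c \<longrightarrow>
     norm (poly (chebyshev_poly n (level_curve \<phi> R r)) z - poly (monic_faber_poly \<phi> c n) z) \<le> K / r"
proof -
  define F where "F = monic_faber_poly \<phi> c n"
  have monic_F: "monic_of_degree n F"
    unfolding F_def by (rule monic_of_degree_monic_faber_poly)
  obtain C N where C: "C > 0" and remainder: "\<And>z. norm z \<ge> N \<Longrightarrow>
      norm (\<phi> z ^ n - of_real c ^ n * poly F z) \<le> C / norm z"
    using monic_faber_poly_remainder[of n] unfolding eventually_at_infinity F_def by metis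
  \<comment> \<open>\<open>r\<close> times the sum of the two errors on the circle, divided by
    \<open>c ^ n\<close>: the first from \<open>near_power_of_\<phi>\<close>, the second from the
    Laurent remainder.\<close>
  define K where "K = (8 * C * c * 8 ^ n + C * c) / c ^ n"
  \<comment> \<open>The bound \<open>2 * c * N\<close> puts both the level curve and the circle into
    \<open>norm z \<ge> N\<close>, where the remainder estimate holds.\<close>
  have "\<forall>\<^sub>F r in at_top. r > max 1 (2 * c / \<rho>) \<and> r > 2 * c * N"
    by (intro eventually_conj eventually_gt_at_top)
  hence "\<forall>\<^sub>F r in at_top. \<forall>z. norm z \<le> 4 * r / c \<longrightarrow>
     norm (poly (chebyshev_poly n (level_curve \<phi> R r)) z - poly F z) \<le> K / r"
    using eventually_level_curve
  proof eventually_elim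
    case (elim r)
    define L where "L = level_curve \<phi> R r"
    define T where "T = chebyshev_poly n L"
    have L: "compact L" "infinite L" "L = {z. norm z > 1 / \<rho> \<and> norm (\<phi> z) = r}"
      using elim by (auto simp: L_def)
    have r: "r > 0" "2 * c / r < \<rho>" "r > 2 * c * N"
      using elim \<rho> by (auto simp: field_simps)
    have cheb: "is_chebyshev_poly n L T"
      unfolding T_def by (rule is_chebyshev_poly_chebyshev_poly[OF L(1,2)])
    hence monic_T: "monic_of_degree n T" by (simp add: is_chebyshev_poly_def)
    \<comment> \<open>The relative excess: \<open>\<epsilon> * r ^ n\<close> equals the remainder
      bound \<open>2 * c * C / r\<close> on the curve.\<close>
    define \<epsilon> where "\<epsilon> = 2 * c * C / r ^ Suc n"
    have \<epsilon>: "\<epsilon> > 0" using c C r by (simp add: \<epsilon>_def)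
    have "c ^ n * norm (poly F z) \<le> (1 + \<epsilon>) * r ^ n" if "z \<in> L" for z
    proof -
      have z: "norm z > 1 / \<rho>" "norm (\<phi> z) = r" using that L(3) by auto
      have lower: "r \<le> 2 * c * norm z" using norm_\<phi>_bounds(1)[OF z(1)] z(2) by simp
      hence "2 * c * N < 2 * c * norm z" using r by linarith
      hence "N \<le> norm z" using c by simp
      have "C / norm z \<le> C / (r / (2 * c))"
        using lower c C r norm_inverse_less(2)[OF z(1)]
        by (intro divide_left_mono) (auto simp: field_simps)
      hence "norm (\<phi> z ^ n - of_real c ^ n * poly F z) \<le> 2 * c * C / r"
        using remainder[OF \<open>N \<le> norm z\<close>] by (simp add: mult_ac)
      moreover have "norm (of_real c ^ n * poly F z)
          \<le> norm (\<phi> z ^ n) + norm (\<phi> z ^ n - of_real c ^ n * poly F z)"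
        by (metis norm_minus_commute norm_triangle_sub)
      ultimately have "c ^ n * norm (poly F z) \<le> r ^ n + 2 * c * C / r"
        using c by (simp add: norm_mult norm_power z(2))
      also have "\<dots> = (1 + \<epsilon>) * r ^ n" using r by (simp add: \<epsilon>_def field_simps)
      finally show ?thesis .
    qed
    hence "norm (poly F z) \<le> (1 + \<epsilon>) * r ^ n / c ^ n" if "z \<in> L" for z
      using that c by (simp add: pos_le_divide_eq mult.commute)
    hence "max_norm_on L F \<le> (1 + \<epsilon>) * r ^ n / c ^ n"
      using L(2) by (intro max_norm_on_le) auto
    moreover have "max_norm_on L T \<le> max_norm_on L F"
      using cheb monic_F by (simp add: is_chebyshev_poly_def)
    ultimately have "norm (poly T z) \<le> (1 + \<epsilon>) * r ^ n / c ^ n" if "z \<in> L" for z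
      using norm_poly_le_max_norm_on[OF L(1) that, of T] by linarith
    hence T_bound: "c ^ n * norm (poly T z) \<le> (1 + \<epsilon>) * r ^ n"
      if "norm z > 1 / \<rho>" "norm (\<phi> z) = r" for z
      using that c L(3) by (simp add: pos_le_divide_eq mult.commute)
    have circle: "norm (poly (T - F) z) \<le> K / r" if z: "norm z = 4 * r / c" for z
    proof -
      have "r \<le> 2 * c * norm z" using z c r(1) by simp
      hence "2 * c * N < 2 * c * norm z" using r by linarith
      hence "norm (\<phi> z ^ n - of_real c ^ n * poly F z) \<le> C / norm z"
        using c by (intro remainder) simp
      also have "\<dots> \<le> C * c / r" unfolding z using c C r(1) by (simp add: field_simps)
      finally have 1: "norm (\<phi> z ^ n - of_real c ^ n * poly F z) \<le> C * c / r" .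
      have 2: "norm (of_real c ^ n * poly T z - \<phi> z ^ n) \<le> 4 * \<epsilon> * (8 * r) ^ n"
        by (rule near_power_of_\<phi>[OF r(1,2) monic_T \<epsilon> T_bound z])
      have "of_real c ^ n * poly (T - F) z
          = (of_real c ^ n * poly T z - \<phi> z ^ n) + (\<phi> z ^ n - of_real c ^ n * poly F z)"
        by (simp add: algebra_simps)
      hence "c ^ n * norm (poly (T - F) z) \<le> 4 * \<epsilon> * (8 * r) ^ n + C * c / r"
        using norm_triangle_mono[OF 2 1] c by (metis abs_of_pos norm_mult norm_of_real norm_power)
      also have "\<dots> = c ^ n * (K / r)"
        using c r(1) by (simp add: K_def \<epsilon>_def power_mult_distrib field_simps)
      finally show ?thesis
        by (rule mult_left_le_imp_le) (use c in simp)
    qed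
    show ?case
    proof (intro allI impI)
      fix z :: complex assume "norm z \<le> 4 * r / c"
      hence z: "z \<in> cball 0 (4 * r / c)" by simp
      have "norm (poly (T - F) z) \<le> K / r"
      proof (rule maximum_modulus_frontier[OF _ _ bounded_cball _ z])
        show "poly (T - F) holomorphic_on interior (cball 0 (4 * r / c))"
          by (intro holomorphic_intros)
        show "continuous_on (closure (cball 0 (4 * r / c))) (poly (T - F))"
          by (intro continuous_intros)
        show "norm (poly (T - F) w) \<le> K / r" if "w \<in> frontier (cball 0 (4 * r / c))" for w
          using that c r(1) by (intro circle) simp
      qed
      thus "norm (poly (chebyshev_poly n (level_curve \<phi> R r)) z - poly F z) \<le> K / r"
        by (simp add: T_def L_def)
    qed
  qed
  thus ?thesis unfolding F_def by blast
qed

lemma chebyshev_poly_tendsto: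
  "((\<lambda>r. poly (chebyshev_poly n (level_curve \<phi> R r)) z)
     \<longlongrightarrow> poly (monic_faber_poly \<phi> c n) z) at_top"
proof -
  obtain K where K: "\<forall>\<^sub>F r in at_top. \<forall>z. norm z \<le> 4 * r / c \<longrightarrow>
     norm (poly (chebyshev_poly n (level_curve \<phi> R r)) z - poly (monic_faber_poly \<phi> c n) z) \<le> K / r"
    using chebyshev_poly_near_monic_faber_poly by blast
  have "\<forall>\<^sub>F r in at_top. norm (poly (chebyshev_poly n (level_curve \<phi> R r)) z
      - poly (monic_faber_poly \<phi> c n) z) \<le> K / r"
    \<comment> \<open>A fixed \<open>z\<close> eventually lies in the growing disc of radius
      \<open>4 * r / c\<close>.\<close>
    using K eventually_ge_at_top[of "c * norm z / 4"]
    by eventually_elim (use c in \<open>simp add: field_simps\<close>)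
  moreover have "((\<lambda>r. K / r) \<longlongrightarrow> 0) at_top"
    by (intro tendsto_divide_0[OF tendsto_const] filterlim_at_top_imp_at_infinity filterlim_ident)
  ultimately have "((\<lambda>r. poly (chebyshev_poly n (level_curve \<phi> R r)) z
      - poly (monic_faber_poly \<phi> c n) z) \<longlongrightarrow> 0) at_top"
    by (rule Lim_null_comparison)
  thus ?thesis by (simp add: LIM_zero_iff)
qed

end

text \<open>The expansion reads \<open>\<phi> z = z * B (1 / z)\<close> with
  \<open>B y = c + y * g y\<close> and \<open>g\<close> the power series with coefficients
  \<open>a\<close>; continuity of \<open>B\<close> at 0 yields \<open>\<rho>\<close>.\<close>

lemma univalent_at_infinity_exists:
  fixes c R :: real
  assumes c: "c > 0" and exp: "has_expansion_at_infinity \<phi> c a" and R: "R > 0"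
    and inj: "inj_on \<phi> {z. norm z > R}"
  obtains B \<rho> where "univalent_at_infinity \<phi> B c R \<rho>"
proof -
  obtain N0 where N0: "\<And>z. norm z \<ge> N0 \<Longrightarrow> (\<lambda>k. a k / z ^ k) sums (\<phi> z - of_real c * z)"
    using exp unfolding has_expansion_at_infinity_def eventually_at_infinity by blast
  define N where "N = max N0 R"
  have N: "N \<ge> R" "N > 0" "\<And>z. norm z \<ge> N \<Longrightarrow> (\<lambda>k. a k / z ^ k) sums (\<phi> z - of_real c * z)"
    using N0 R by (auto simp: N_def)
  define g where "g = (\<lambda>w::complex. \<Sum>k. a k * w ^ k)"
  define B where "B y = of_real c + y * g y" for y
  have \<phi>: "\<phi> z = z * B (1 / z)" if "norm z \<ge> N" for z
  proof -
    have "(\<lambda>k. a k * (1 / z) ^ k) sums (\<phi> z - of_real c * z)"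
      using N(3)[OF that] by (simp add: power_one_over field_simps)
    hence "\<phi> z - of_real c * z = g (1 / z)" by (simp add: g_def sums_unique)
    moreover have "z \<noteq> 0" using that N(2) by auto
    ultimately show ?thesis by (simp add: B_def field_simps)
  qed
  \<comment> \<open>Convergence at the single point \<open>N\<close> gives convergence on the whole
    open disc of radius \<open>1 / N\<close>.\<close>
  have sm: "summable (\<lambda>k. a k * (1 / of_real N) ^ k)"
    using N(3)[of "of_real N"] N(2) by (auto simp: power_one_over field_simps dest: sums_summable)
  have "g holomorphic_on ball 0 (1 / N)"
  proof (rule power_series_holomorphic[where a = a])
    fix w :: complex assume "w \<in> ball 0 (1 / N)"
    hence "summable (\<lambda>k. a k * w ^ k)"
      using sm N(2) by (auto intro!: powser_inside[of a "1 / of_real N"] simp: norm_divide)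
    thus "(\<lambda>k. a k * (w - 0) ^ k) sums g w"
      by (simp add: g_def summable_sums)
  qed
  hence hol: "B holomorphic_on ball 0 (1 / N)"
    unfolding B_def by (intro holomorphic_intros)
  hence "isCont B 0"
    using N(2) by (intro continuous_on_interior[OF holomorphic_on_imp_continuous_on]) auto
  then obtain d where d: "d > 0" "\<And>y. norm y < d \<Longrightarrow> norm (B y - of_real c) < c / 2"
  proof -
    have "c / 2 > 0" using c by simp
    thus ?thesis
      using \<open>isCont B 0\<close> that unfolding continuous_at_eps_delta
      by (metis B_def add.right_neutral dist_0_norm dist_commute dist_norm mult_zero_left)
  qed
  define \<rho> where "\<rho> = min d (1 / N)"
  have \<rho>: "\<rho> > 0" "\<rho> \<le> d" "\<rho> \<le> 1 / N" using d N(2) by (auto simp: \<rho>_def)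
  have N_le: "N \<le> 1 / \<rho>" using \<rho> N(2) by (simp add: field_simps)
  have "univalent_at_infinity \<phi> B c R \<rho>"
  proof
    show "R \<le> 1 / \<rho>" using N(1) N_le by linarith
    show "B holomorphic_on ball 0 \<rho>" by (rule holomorphic_on_subset[OF hol]) (use \<rho> in auto)
    show "B 0 = of_real c" by (simp add: B_def)
    show "\<phi> z = z * B (1 / z)" if "norm z > 1 / \<rho>" for z
      using that N_le by (intro \<phi>) linarith
    show "c / 2 \<le> norm (B y) \<and> norm (B y) \<le> 2 * c" if "norm y < \<rho>" for y
    proof -
      have "norm (B y - of_real c) < c / 2" using that \<rho> by (intro d(2)) linarith
      moreover have "norm (B y) \<le> norm (complex_of_real c) + norm (B y - of_real c)"
        by (metis norm_triangle_sub)
      moreover have "norm (complex_of_real c) \<le> norm (B y) + norm (B y - of_real c)"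
        by (metis norm_minus_commute norm_triangle_sub)
      ultimately show ?thesis using c by simp
    qed
  qed (use c R \<rho> inj in auto)
  thus ?thesis by (rule that)
qed

theorem theorem2p1:
  fixes \<phi> :: "complex \<Rightarrow> complex" and c :: real and a :: "nat \<Rightarrow> complex"
    and R :: real and n :: nat and z :: complex
  assumes "c > 0"
    and "has_expansion_at_infinity \<phi> c a"
    and "R > 0"
    and "\<phi> analytic_on {z. norm z > R}"
    and "inj_on \<phi> {z. norm z > R}"
  shows "((\<lambda>r. poly (chebyshev_poly n (level_curve \<phi> R r)) z)
           \<longlongrightarrow> poly (monic_faber_poly \<phi> c n) z) at_top"
proof -
  obtain B \<rho> where "univalent_at_infinity \<phi> B c R \<rho>"
    using univalent_at_infinity_exists[OF assms(1,2,3,5)] .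
  thus ?thesis by (rule univalent_at_infinity.chebyshev_poly_tendsto)
qed

end
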